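(* Consider the block Gibbs sampler defined in the context, with $K\ge3$ and $m_i\ge2$ for all $i$. Let $d>0$, $\phi_1>0$, $\phi_2>0$, and let $$C_B=\{(\theta,\mu): v_1(\theta,\mu)<d/\phi_1\}\cap\{(\theta,\mu): v_2(\theta)<d/\phi_2\}.$$ Let $q(\lambda,\theta,\mu)$ be the density on $\mathbb{R}_+^2\times\mathbb{R}^K\times\mathbb{R}$ defined by $$q(\lambda,\theta,\mu)=\left[\frac{h_1(\lambda_\theta)}{\int_{\mathbb{R}_+}h_1(\lambda_\theta)\,d\lambda_\theta}\right]\left[\frac{h_2(\lambda_e)}{\int_{\mathbb{R}_+}h_2(\lambda_e)\,d\lambda_e}\right]f(\xi\mid\lambda,y),$$ where $$h_1(\lambda_\theta)=\begin{cases}\mathrm{Gamma}\left(\frac K2+a_1,b_1;\lambda_\theta\right),&\lambda_\theta<\lambda_\theta^*,\\ \mathrm{Gamma}\left(\frac K2+a_1,\frac{d}{2\phi_1}+b_1;\lambda_\theta\right),&\lambda_\theta\ge\lambda_\theta^*,\end{cases}\qquad \lambda_\theta^*=\frac{\phi_1(K+2a_1)}{d}\log\left(1+\frac{d}{2b_1\phi_1}\right),$$ and $$h_2(\lambda_e)=\begin{cases}\mathrm{Gamma}\left(\frac M2+a_2,\frac{\mathrm{SSE}}2+b_2;\lambda_e\right),&\lambda_e<\lambda_e^*,\\ \mathrm{Gamma}\left(\frac M2+a_2,\frac{\phi_2\mathrm{SSE}+d}{2\phi_2}+b_2;\lambda_e\right),&\lambda_e\ge\lambda_e^*,\end{cases}\qquad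 \lambda_e^*=\frac{\phi_2(M+2a_2)}{d}\log\left(1+\frac{d}{\phi_2(2b_2+\mathrm{SSE})}\right).$$ Set $\varepsilon_B=\left[\int_{\mathbb{R}_+}h_1(\lambda_\theta)\,d\lambda_\theta\right]\left[\int_{\mathbb{R}_+}h_2(\lambda_e)\,d\lambda_e\right]$. Then the Markov transition density of the block Gibbs sampler satisfies $$k(\lambda,\theta,\mu\mid\lambda',\theta',\mu')\ge\varepsilon_B\,q(\lambda,\theta,\mu)\qquad\text{for all }(\theta',\mu')\in C_B.$$
   Context: Model. $K$ and $m_1,\ldots,m_K$ are positive integers, $M=\sum_{i=1}^K m_i$, and $y=(y_{ij})$, $1\le i\le K$, $1\le j\le m_i$, is fixed real data. $a_1,b_1,a_2,b_2,s_0$ are known positive constants and $m_0\in\mathbb{R}$ is known. $\mathrm{Gamma}(\alpha,\beta)$ has density proportional to $w^{\alpha-1}e^{-w\beta}I(w>0)$, and $\mathrm{Gamma}(\alpha,\beta;x)$ denotes the value of the $\mathrm{Gamma}(\alpha,\beta)$ density at the point $x>0$. Hierarchical model: given $\theta=(\theta_1,\ldots,\theta_K)^T$ and $\lambda_e$, the $Y_{ij}$ are independent with $Y_{ij}\sim\mathrm{N}(\theta_i,\lambda_e^{-1})$; given $\mu,\lambda_\theta$, the variables $\theta_1,\ldots,\theta_K,\lambda_e$ are independent with $\theta_i\sim\mathrm{N}(\mu,\lambda_\theta^{-1})$ and $\lambda_e\sim\mathrm{Gamma}(a_2,b_2)$; $\mu\sim\mathrm{N}(m_0,s_0^{-1})$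 and $\lambda_\theta\sim\mathrm{Gamma}(a_1,b_1)$ are independent. Write $\lambda=(\lambda_\theta,\lambda_e)^T$ and $\xi=(\theta_1,\ldots,\theta_K,\mu)^T$. The posterior is the conditional distribution of $(\theta,\mu,\lambda)$ given $Y=y$. Notation: $\bar y_i=m_i^{-1}\sum_{j}y_{ij}$, $\mathrm{SSE}=\sum_{i,j}(y_{ij}-\bar y_i)^2$, $v_1(\theta,\mu)=\sum_{i=1}^K(\theta_i-\mu)^2$, $v_2(\theta)=\sum_{i=1}^K m_i(\theta_i-\bar y_i)^2$. Block Gibbs sampler. The Markov chain on $(\lambda,\xi)\in\mathbb{R}_+^2\times\mathbb{R}^{K+1}$ whose transition $(\lambda',\xi')\to(\lambda,\xi)$ has density $k(\lambda,\xi\mid\lambda',\xi')=f(\lambda_\theta\mid\xi',y)f(\lambda_e\mid\xi',y)f(\xi\mid\lambda,y)$ (also written $k(\lambda,\theta,\mu\mid\lambda',\theta',\mu')$), where the $f$'s are the posterior conditional densities: $\lambda_\theta\mid\xi,y\sim\mathrm{Gamma}\left(\frac K2+a_1,\frac{v_1(\theta,\mu)}2+b_1\right)$, $\lambda_e\mid\xi,y\sim\mathrm{Gamma}\left(\frac M2+a_2,\frac{v_2(\theta)+\mathrm{SSE}}2+b_2\right)$, and $\xi\mid\lambda,y$ is multivariate normal with, for $t=\sum_{i=1}^K\frac{m_i\lambda_\theta\lambda_e}{\lambda_\theta+m_i\lambda_e}$, $E(\mu\mid\lambda)=\frac1{s_0+t}\left[\sum_{i=1}^K\frac{m_i\lambda_\theta\lambda_e\bar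 y_i}{\lambda_\theta+m_i\lambda_e}+m_0s_0\right]$, $E(\theta_i\mid\lambda)=\frac{\lambda_\theta E(\mu\mid\lambda)+m_i\lambda_e\bar y_i}{\lambda_\theta+m_i\lambda_e}$, $\mathrm{Var}(\mu\mid\lambda)=\frac1{s_0+t}$, $\mathrm{Var}(\theta_i\mid\lambda)=\frac1{\lambda_\theta+m_i\lambda_e}\left[1+\frac{\lambda_\theta^2}{(\lambda_\theta+m_i\lambda_e)(s_0+t)}\right]$, $\mathrm{Cov}(\theta_i,\mu\mid\lambda)=\frac{\lambda_\theta}{(\lambda_\theta+m_i\lambda_e)(s_0+t)}$, $\mathrm{Cov}(\theta_i,\theta_j\mid\lambda)=\frac{\lambda_\theta^2}{(\lambda_\theta+m_i\lambda_e)(\lambda_\theta+m_j\lambda_e)(s_0+t)}$ for $i\ne j$. *)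

theory Defs
  imports "HOL-Probability.Probability"
begin

text \<open>Shape--rate parametrisation.\<close>

definition gamma_density :: "real \<Rightarrow> real \<Rightarrow> real \<Rightarrow> real" where
  "gamma_density \<alpha> \<beta> x =
     (if x > 0 then \<beta> powr \<alpha> / Gamma \<alpha> * x powr (\<alpha> - 1) * exp (- x * \<beta>) else 0)"

definition mvn_density :: "real ^ 'n \<Rightarrow> real ^ 'n ^ 'n \<Rightarrow> real ^ 'n \<Rightarrow> real" where
  "mvn_density c \<Sigma> x =
     exp (- ((x - c) \<bullet> (matrix_inv \<Sigma> *v (x - c))) / 2) / sqrt ((2 * pi) ^ CARD('n) * det \<Sigma>)"

text \<open>
  The groups \<open>1, \<dots>, K\<close> are the elements of a finite type \<open>'k\<close>, so \<open>K = CARD('k)\<close>.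
  Only the values \<open>y i j\<close> with \<open>1 \<le> j \<le> m i\<close> are data.
\<close>

definition ybar :: "('k \<Rightarrow> nat) \<Rightarrow> ('k \<Rightarrow> nat \<Rightarrow> real) \<Rightarrow> 'k \<Rightarrow> real" where
  "ybar m y i = (\<Sum>j = 1..m i. y i j) / real (m i)"

definition SSE :: "('k::finite \<Rightarrow> nat) \<Rightarrow> ('k \<Rightarrow> nat \<Rightarrow> real) \<Rightarrow> real" where
  "SSE m y = (\<Sum>i\<in>UNIV. \<Sum>j = 1..m i. (y i j - ybar m y i)\<^sup>2)"

definition total_obs :: "('k::finite \<Rightarrow> nat) \<Rightarrow> nat" where
  "total_obs m = (\<Sum>i\<in>UNIV. m i)"

definition v1 :: "real ^ 'k \<Rightarrow> real \<Rightarrow> real" where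
  "v1 \<theta> \<mu> = (\<Sum>i\<in>UNIV. (\<theta> $ i - \<mu>)\<^sup>2)"

definition v2 :: "('k \<Rightarrow> nat) \<Rightarrow> ('k \<Rightarrow> nat \<Rightarrow> real) \<Rightarrow> real ^ 'k \<Rightarrow> real" where
  "v2 m y \<theta> = (\<Sum>i\<in>UNIV. real (m i) * (\<theta> $ i - ybar m y i)\<^sup>2)"

definition lambda_theta_cond :: "real \<Rightarrow> real \<Rightarrow> real ^ 'k \<Rightarrow> real \<Rightarrow> real \<Rightarrow> real" where
  "lambda_theta_cond a1 b1 \<theta> \<mu> =
     gamma_density (real CARD('k) / 2 + a1) (v1 \<theta> \<mu> / 2 + b1)"

definition lambda_e_cond ::
  "('k \<Rightarrow> nat) \<Rightarrow> ('k \<Rightarrow> nat \<Rightarrow> real) \<Rightarrow> real \<Rightarrow> real \<Rightarrow> real ^ 'k \<Rightarrow> real \<Rightarrow> real" where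
  "lambda_e_cond m y a2 b2 \<theta> =
     gamma_density (real (total_obs m) / 2 + a2) ((v2 m y \<theta> + SSE m y) / 2 + b2)"

text \<open>
  The vector \<open>\<xi> = (\<theta>\<^sub>1, \<dots>, \<theta>\<^sub>K, \<mu>)\<close> is indexed by \<open>'k option\<close>:
  index \<open>Some i\<close> is the coordinate \<open>\<theta>\<^sub>i\<close> and \<open>None\<close> is the coordinate \<open>\<mu>\<close>.
\<close>

definition xi_vec :: "real ^ 'k \<Rightarrow> real \<Rightarrow> real ^ ('k option)" where
  "xi_vec \<theta> \<mu> = (\<chi> u. case u of Some i \<Rightarrow> \<theta> $ i | None \<Rightarrow> \<mu>)"

definition t_sum :: "('k::finite \<Rightarrow> nat) \<Rightarrow> real \<Rightarrow> real \<Rightarrow> real" where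
  "t_sum m lt le = (\<Sum>i\<in>UNIV. real (m i) * lt * le / (lt + real (m i) * le))"

definition mu_mean ::
  "('k::finite \<Rightarrow> nat) \<Rightarrow> ('k \<Rightarrow> nat \<Rightarrow> real) \<Rightarrow> real \<Rightarrow> real \<Rightarrow> real \<Rightarrow> real \<Rightarrow> real" where
  "mu_mean m y m0 s0 lt le =
     1 / (s0 + t_sum m lt le) *
       ((\<Sum>i\<in>UNIV. real (m i) * lt * le * ybar m y i / (lt + real (m i) * le)) + m0 * s0)"

definition xi_mean ::
  "('k::finite \<Rightarrow> nat) \<Rightarrow> ('k \<Rightarrow> nat \<Rightarrow> real) \<Rightarrow> real \<Rightarrow> real \<Rightarrow> real \<Rightarrow> real \<Rightarrow> real ^ ('k option)" where
  "xi_mean m y m0 s0 lt le =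
     xi_vec
       (\<chi> i. (lt * mu_mean m y m0 s0 lt le + real (m i) * le * ybar m y i) / (lt + real (m i) * le))
       (mu_mean m y m0 s0 lt le)"

definition xi_cov ::
  "('k::finite \<Rightarrow> nat) \<Rightarrow> real \<Rightarrow> real \<Rightarrow> real \<Rightarrow> real ^ ('k option) ^ ('k option)" where
  "xi_cov m s0 lt le =
     (let s = s0 + t_sum m lt le; p = (\<lambda>i. lt + real (m i) * le) in
      \<chi> u w. case (u, w) of
          (None, None) \<Rightarrow> 1 / s
        | (Some i, None) \<Rightarrow> lt / (p i * s)
        | (None, Some j) \<Rightarrow> lt / (p j * s)
        | (Some i, Some j) \<Rightarrow>
            (if i = j then 1 / p i * (1 + lt\<^sup>2 / (p i * s)) else lt\<^sup>2 / (p i * p j * s)))"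

definition xi_cond ::
  "('k::finite \<Rightarrow> nat) \<Rightarrow> ('k \<Rightarrow> nat \<Rightarrow> real) \<Rightarrow> real \<Rightarrow> real \<Rightarrow> real \<Rightarrow> real \<Rightarrow> real ^ 'k \<Rightarrow> real \<Rightarrow> real"
where
  "xi_cond m y m0 s0 lt le \<theta> \<mu> =
     mvn_density (xi_mean m y m0 s0 lt le) (xi_cov m s0 lt le) (xi_vec \<theta> \<mu>)"

text \<open>
  States are written \<open>((\<lambda>\<^sub>\<theta>, \<lambda>\<^sub>e), (\<theta>, \<mu>))\<close>. In \<open>gibbs_density\<close> the current state comes first and
  the new state second, so the conditionals of the precisions see only the old \<open>(\<theta>, \<mu>)\<close>.
\<close>

type_synonym 'k state = "(real \<times> real) \<times> ((real ^ 'k) \<times> real)"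

fun gibbs_density ::
  "('k::finite \<Rightarrow> nat) \<Rightarrow> ('k \<Rightarrow> nat \<Rightarrow> real) \<Rightarrow> real \<Rightarrow> real \<Rightarrow> real \<Rightarrow> real \<Rightarrow> real \<Rightarrow> real \<Rightarrow>
     'k state \<Rightarrow> 'k state \<Rightarrow> real" where
  "gibbs_density m y a1 b1 a2 b2 m0 s0 ((lt', le'), (\<theta>', \<mu>')) ((lt, le), (\<theta>, \<mu>)) =
     lambda_theta_cond a1 b1 \<theta>' \<mu>' lt * lambda_e_cond m y a2 b2 \<theta>' le * xi_cond m y m0 s0 lt le \<theta> \<mu>"

definition C_B ::
  "('k::finite \<Rightarrow> nat) \<Rightarrow> ('k \<Rightarrow> nat \<Rightarrow> real) \<Rightarrow> real \<Rightarrow> real \<Rightarrow> real \<Rightarrow> ((real ^ 'k) \<times> real) set" where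
  "C_B m y d \<phi>1 \<phi>2 = {(\<theta>, \<mu>). v1 \<theta> \<mu> < d / \<phi>1} \<inter> {(\<theta>, \<mu>). v2 m y \<theta> < d / \<phi>2}"

definition lambda_theta_star :: "nat \<Rightarrow> real \<Rightarrow> real \<Rightarrow> real \<Rightarrow> real \<Rightarrow> real" where
  "lambda_theta_star K a1 b1 d \<phi>1 = \<phi>1 * (real K + 2 * a1) / d * ln (1 + d / (2 * b1 * \<phi>1))"

definition h1 :: "nat \<Rightarrow> real \<Rightarrow> real \<Rightarrow> real \<Rightarrow> real \<Rightarrow> real \<Rightarrow> real" where
  "h1 K a1 b1 d \<phi>1 lt =
     (if lt < lambda_theta_star K a1 b1 d \<phi>1
      then gamma_density (real K / 2 + a1) b1 lt
      else gamma_density (real K / 2 + a1) (d / (2 * \<phi>1) + b1) lt)"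

definition lambda_e_star ::
  "('k::finite \<Rightarrow> nat) \<Rightarrow> ('k \<Rightarrow> nat \<Rightarrow> real) \<Rightarrow> real \<Rightarrow> real \<Rightarrow> real \<Rightarrow> real \<Rightarrow> real" where
  "lambda_e_star m y a2 b2 d \<phi>2 =
     \<phi>2 * (real (total_obs m) + 2 * a2) / d * ln (1 + d / (\<phi>2 * (2 * b2 + SSE m y)))"

definition h2 ::
  "('k::finite \<Rightarrow> nat) \<Rightarrow> ('k \<Rightarrow> nat \<Rightarrow> real) \<Rightarrow> real \<Rightarrow> real \<Rightarrow> real \<Rightarrow> real \<Rightarrow> real \<Rightarrow> real" where
  "h2 m y a2 b2 d \<phi>2 le =
     (if le < lambda_e_star m y a2 b2 d \<phi>2
      then gamma_density (real (total_obs m) / 2 + a2) (SSE m y / 2 + b2) le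
      else gamma_density (real (total_obs m) / 2 + a2) ((\<phi>2 * SSE m y + d) / (2 * \<phi>2) + b2) le)"

definition epsilon_B ::
  "('k::finite \<Rightarrow> nat) \<Rightarrow> ('k \<Rightarrow> nat \<Rightarrow> real) \<Rightarrow> real \<Rightarrow> real \<Rightarrow> real \<Rightarrow> real \<Rightarrow>
     real \<Rightarrow> real \<Rightarrow> real \<Rightarrow> real" where
  "epsilon_B m y a1 b1 a2 b2 d \<phi>1 \<phi>2 =
     (LBINT x:{0<..}. h1 CARD('k) a1 b1 d \<phi>1 x) * (LBINT x:{0<..}. h2 m y a2 b2 d \<phi>2 x)"

text \<open>
  Since \<open>gamma_density\<close> vanishes off the positive half-line, \<open>q_density\<close> vanishes unless both
  precisions are positive.
\<close>

fun q_density ::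
  "('k::finite \<Rightarrow> nat) \<Rightarrow> ('k \<Rightarrow> nat \<Rightarrow> real) \<Rightarrow> real \<Rightarrow> real \<Rightarrow> real \<Rightarrow> real \<Rightarrow> real \<Rightarrow> real \<Rightarrow>
     real \<Rightarrow> real \<Rightarrow> real \<Rightarrow> 'k state \<Rightarrow> real" where
  "q_density m y a1 b1 a2 b2 m0 s0 d \<phi>1 \<phi>2 ((lt, le), (\<theta>, \<mu>)) =
     (h1 CARD('k) a1 b1 d \<phi>1 lt / (LBINT x:{0<..}. h1 CARD('k) a1 b1 d \<phi>1 x)) *
     (h2 m y a2 b2 d \<phi>2 le / (LBINT x:{0<..}. h2 m y a2 b2 d \<phi>2 x)) *
     xi_cond m y m0 s0 lt le \<theta> \<mu>"

definition is_prob_density :: "('a::euclidean_space \<Rightarrow> real) \<Rightarrow> bool" where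
  "is_prob_density f \<longleftrightarrow>
     f \<in> borel_measurable lborel \<and> (\<forall>x. 0 \<le> f x) \<and> (\<integral>\<^sup>+ x. ennreal (f x) \<partial>lborel) = 1"

end

theory Submission imports Defs begin

text \<open>
  For fixed \<open>x > 0\<close> the logarithm of \<open>gamma_density \<alpha> \<beta> x\<close> is, up to a constant,
  \<open>\<alpha> ln \<beta> - x \<beta>\<close>, which is concave in \<open>\<beta>\<close>. Over an interval of rates \<open>[b, B]\<close> the density
  is therefore minimal at an end point, and the two end point values cross at
  \<open>x = \<alpha> ln (B / b) / (B - b)\<close>. With the rates allowed by the small set, \<open>h1\<close> and \<open>h2\<close> are these
  minima, and the minorization follows by multiplying with the common factor \<open>f(\<xi> | \<lambda>, y)\<close>.
  That \<open>q\<close> integrates to one rests on writing \<open>f(\<xi> | \<lambda>, y)\<close> as the normal density of \<open>\<mu>\<close>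
  times normal densities of the \<open>\<theta>\<^sub>i\<close> given \<open>\<mu>\<close>.
\<close>

section \<open>Gamma densities as functions of the rate\<close>

lemma gamma_density_exp_form:
  assumes "x > 0" "\<beta> > 0"
  shows "gamma_density \<alpha> \<beta> x = exp (\<alpha> * ln \<beta> - x * \<beta>) * (x powr (\<alpha> - 1) / Gamma \<alpha>)"
  using assms by (simp add: gamma_density_def powr_def exp_diff exp_minus field_simps)

text \<open>In the exponential form the rate enters only through the exponent, so comparing two
  rates means comparing exponents, an affine inequality in \<open>x\<close>. At the crossing point
  both values agree, and for \<open>x \<le> 0\<close> both are 0, so the identity needs no sign
  condition on \<open>x\<close>.\<close>

lemma min_gamma_density:
  assumes "0 < b" "b < B" "0 < \<alpha>"
  shows "min (gamma_density \<alpha> b x) (gamma_density \<alpha> B x) =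
    (if x < \<alpha> / (B - b) * ln (B / b) then gamma_density \<alpha> b x else gamma_density \<alpha> B x)"
proof (cases "x > 0")
  case True
  have pos: "x powr (\<alpha> - 1) / Gamma \<alpha> > 0"
    using True assms by simp
  have "gamma_density \<alpha> B x \<le> gamma_density \<alpha> b x \<longleftrightarrow> \<alpha> * ln B - x * B \<le> \<alpha> * ln b - x * b"
    using gamma_density_exp_form[OF True, of b] gamma_density_exp_form[OF True, of B] assms pos
    by (simp add: mult_le_cancel_right del: times_divide_eq_right)
  also have "\<dots> \<longleftrightarrow> \<alpha> / (B - b) * ln (B / b) \<le> x"
    using assms by (simp add: ln_div field_simps)
  finally show ?thesis by auto
qed (simp add: gamma_density_def)

text \<open>The negated exponent is convex in the rate, hence at most the larger of its values at
  \<open>b\<close> and \<open>B\<close>; exponentiating turns this into a lower bound for the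
  density.\<close>

lemma gamma_density_ge_min:
  assumes "0 < b" "b \<le> \<beta>" "\<beta> \<le> B" "0 < \<alpha>"
  shows "min (gamma_density \<alpha> b x) (gamma_density \<alpha> B x) \<le> gamma_density \<alpha> \<beta> x"
proof (cases "x > 0")
  case True
  have pos: "x powr (\<alpha> - 1) / Gamma \<alpha> > 0"
    using True assms by simp
  have "convex_on {b..B} (\<lambda>\<beta>. \<alpha> * (- ln \<beta>) + x * \<beta>)"
    using ln_concave assms True
    by (intro convex_on_add convex_on_cmul)
       (auto simp: convex_on_ident concave_on_def intro: convex_on_subset)
  then have "\<alpha> * (- ln \<beta>) + x * \<beta> \<le> max (\<alpha> * (- ln b) + x * b) (\<alpha> * (- ln B) + x * B)"
    using assms by (intro convex_on_le_max) auto
  then have "gamma_density \<alpha> b x \<le> gamma_density \<alpha> \<beta> x \<or> gamma_density \<alpha> B x \<le> gamma_density \<alpha> \<beta> x"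
    using assms pos by (auto simp: gamma_density_exp_form[OF True] max_def mult_le_cancel_right
        simp del: times_divide_eq_right split: if_splits)
  then show ?thesis by auto
qed (simp add: gamma_density_def)

text \<open>Comes from absolute convergence of the complex Gamma integral: the norm of its integrand
  is the real kernel. Borel measurability then allows passing from the completed measure to
  \<open>lborel\<close>.\<close>

lemma integrable_gamma_density:
  assumes "\<alpha> > 0" "\<beta> > 0"
  shows "integrable lborel (gamma_density \<alpha> \<beta>)"
proof -
  have "(\<lambda>t. complex_of_real t powr (of_real \<alpha> - 1) / of_real (exp (\<beta> * t))) absolutely_integrable_on {0<..}"
    using absolutely_integrable_Gamma_integral[of "of_real \<alpha>" \<beta>] assms by simp
  then have "set_integrable lebesgue {0<..}
      (\<lambda>t. norm (complex_of_real t powr (of_real \<alpha> - 1) / of_real (exp (\<beta> * t))))"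
    by (rule set_integrable_norm)
  then have "integrable lebesgue (\<lambda>t. \<beta> powr \<alpha> / Gamma \<alpha> * (indicat_real {0<..} t *\<^sub>R norm (complex_of_real t powr (of_real \<alpha> - 1) / of_real (exp (\<beta> * t)))))"
    unfolding set_integrable_def by (rule integrable_mult_right)
  also have "(\<lambda>t. \<beta> powr \<alpha> / Gamma \<alpha> * (indicat_real {0<..} t *\<^sub>R norm (complex_of_real t powr (of_real \<alpha> - 1) / of_real (exp (\<beta> * t))))) = gamma_density \<alpha> \<beta>"
    by (auto simp: fun_eq_iff gamma_density_def norm_divide norm_powr_real_powr exp_minus field_simps indicator_def)
  finally show ?thesis
    by (subst (asm) integrable_completion) (auto simp: gamma_density_def[abs_def])
qed

text \<open>A zero integral would make \<open>f\<close> vanish almost everywhere, so the unit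
  interval, where \<open>f\<close> is positive, would be a null set.\<close>

lemma integral_pos_of_pos_on_halfline:
  fixes f :: "real \<Rightarrow> real"
  assumes "integrable lborel f" "\<And>x. 0 \<le> f x" "\<And>x. 0 < x \<Longrightarrow> 0 < f x"
  shows "0 < integral\<^sup>L lborel f"
proof -
  have "integral\<^sup>L lborel f \<noteq> 0"
  proof
    assume "integral\<^sup>L lborel f = 0"
    then have "AE x in lborel. f x = 0"
      using integral_nonneg_eq_0_iff_AE[of lborel f] assms by simp
    then have "AE x in lborel. x \<notin> {0<..<1::real}"
      by eventually_elim (use assms(3) in force)
    then have "{0<..<1::real} \<in> null_sets lborel"
      by (subst (asm) AE_iff_null_sets[symmetric]) auto
    then show False
      by (auto simp: null_sets_def)
  qed
  moreover have "0 \<le> integral\<^sup>L lborel f" using assms by simp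
  ultimately show ?thesis by simp
qed

section \<open>Hierarchical factorization of the multivariate normal density\<close>

lemma sum_UNIV_option: "(\<Sum>u\<in>UNIV. f u) = f None + (\<Sum>i\<in>UNIV. f (Some i))"
  for f :: "'k::finite option \<Rightarrow> 'a::comm_monoid_add"
  by (simp add: UNIV_option_conv sum.reindex)

lemma prod_UNIV_option: "(\<Prod>u\<in>UNIV. f u) = f None * (\<Prod>i\<in>UNIV. f (Some i))"
  for f :: "'k::finite option \<Rightarrow> 'a::comm_monoid_mult"
  by (simp add: UNIV_option_conv prod.reindex)

text \<open>For square matrices a right inverse is two-sided, and two-sided inverses are unique, so
  the choice in \<open>matrix_inv\<close> is determined.\<close>

lemma matrix_inv_eqI:
  fixes A B :: "real ^ 'n ^ 'n"
  assumes "A ** B = mat 1"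
  shows "matrix_inv A = B"
proof -
  have BA: "B ** A = mat 1" using assms by (simp add: matrix_left_right_inverse)
  then have "A ** matrix_inv A = mat 1 \<and> matrix_inv A ** A = mat 1"
    unfolding matrix_inv_def using assms by (rule_tac someI[of _ B]) simp
  then show ?thesis
    by (metis BA matrix_mul_assoc matrix_mul_lid matrix_mul_rid)
qed

text \<open>Such a \<Sigma> belongs to a root coordinate \<open>None\<close> of precision
  \<open>s\<close> and, given the root, independent coordinates \<open>Some i\<close> of precision
  \<open>p i\<close>. Factoring \<Sigma> through a unit triangular matrix makes the determinant and
  the quadratic form split by coordinate.\<close>

lemma mvn_density_hierarchical:
  fixes p r :: "'k::finite \<Rightarrow> real" and c x :: "real ^ ('k option)"
  assumes "s > 0" "\<And>i. p i > 0"
    and \<Sigma>: "\<Sigma> = (\<chi> u w. case (u, w) of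
          (None, None) \<Rightarrow> 1 / s
        | (Some i, None) \<Rightarrow> r i / s
        | (None, Some j) \<Rightarrow> r j / s
        | (Some i, Some j) \<Rightarrow> (if i = j then 1 / p i else 0) + r i * r j / s)"
  shows "mvn_density c \<Sigma> x =
    normal_density (c $ None) (1 / sqrt s) (x $ None) *
    (\<Prod>i\<in>UNIV. normal_density (c $ Some i + r i * (x $ None - c $ None)) (1 / sqrt (p i)) (x $ Some i))"
proof -
  have nz: "s \<noteq> 0" "p i \<noteq> 0" for i
    using assms(1) assms(2)[of i] by auto
  \<comment> \<open>\<open>x - c = L \<epsilon>\<close> with independent \<open>\<epsilon>\<close> of covariance \<open>D\<close>: the \<open>Some i\<close> coordinate regresses on
    the \<open>None\<close> coordinate with slope \<open>r i\<close>. \<open>N\<close> and \<open>E\<close> are the inverses of \<open>L\<close> and \<open>D\<close>.\<close>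
  define L :: "real ^ 'k option ^ 'k option" where "L = (\<chi> u w. case (u, w) of
          (None, None) \<Rightarrow> 1
        | (Some i, None) \<Rightarrow> r i
        | (None, Some j) \<Rightarrow> 0
        | (Some i, Some j) \<Rightarrow> (if i = j then 1 else 0))"
  define D :: "real ^ 'k option ^ 'k option" where
    "D = (\<chi> u w. if u = w then (case u of None \<Rightarrow> 1 / s | Some i \<Rightarrow> 1 / p i) else 0)"
  have \<Sigma>_eq: "\<Sigma> = L ** (D ** transpose L)"
    by (simp add: vec_eq_iff matrix_matrix_mult_def L_def D_def \<Sigma> transpose_def sum_UNIV_option
        split_option_all if_distrib if_distribR sum.delta cong: if_cong)

  define N :: "real ^ 'k option ^ 'k option" where "N = (\<chi> u w. case (u, w) of
          (None, None) \<Rightarrow> 1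
        | (Some i, None) \<Rightarrow> - r i
        | (None, Some j) \<Rightarrow> 0
        | (Some i, Some j) \<Rightarrow> (if i = j then 1 else 0))"
  define E :: "real ^ 'k option ^ 'k option" where
    "E = (\<chi> u w. if u = w then (case u of None \<Rightarrow> s | Some i \<Rightarrow> p i) else 0)"
  have LN: "L ** N = mat 1"
    by (simp add: vec_eq_iff matrix_matrix_mult_def L_def N_def mat_def sum_UNIV_option
        split_option_all mult_delta_left mult_delta_right sum_negf sum.delta cong: if_cong)
  have DE: "D ** E = mat 1"
    using nz by (simp add: vec_eq_iff matrix_matrix_mult_def D_def E_def mat_def mult_delta_left
        split: option.split)
  have "transpose L ** transpose N = mat 1"
    using LN by (metis matrix_left_right_inverse matrix_transpose_mul transpose_mat)
  \<comment> \<open>Cancellation runs from the inside out: \<open>transpose L\<close> with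
    \<open>transpose N\<close>, then \<open>D\<close> with \<open>E\<close>, then \<open>L\<close>
    with \<open>N\<close>.\<close>
  then have "\<Sigma> ** (transpose N ** (E ** N)) = L ** ((D ** E) ** N)"
    unfolding \<Sigma>_eq by (metis matrix_mul_assoc matrix_mul_lid)
  then have inv: "matrix_inv \<Sigma> = transpose N ** (E ** N)"
    by (intro matrix_inv_eqI) (simp add: DE LN)

  have "det L = 1"
  proof -
    \<comment> \<open>\<open>transpose L\<close> is the identity with a combination of the other
      rows added to row \<open>None\<close>, which leaves the determinant at 1.\<close>
    let ?x = "\<Sum>i\<in>UNIV. r i *s row (Some i) (mat 1 :: real ^ 'k option ^ 'k option)"
    have "?x \<in> vec.span {row j (mat 1 :: real ^ 'k option ^ 'k option) |j. j \<noteq> None}"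
      by (intro vec.span_sum vec.span_scale vec.span_base) auto
    from det_row_span[OF this]
    have "det (\<chi> k. if k = None then row None (mat 1) + ?x else row k (mat 1) :: real ^ 'k option ^ 'k option) = 1"
      by simp
    also have "(\<chi> k. if k = None then row None (mat 1) + ?x else row k (mat 1) :: real ^ 'k option ^ 'k option) = transpose L"
      by (auto simp: vec_eq_iff L_def transpose_def row_def mat_def split_option_all
          mult_delta_left mult_delta_right sum.delta cong: if_cong split: option.split)
    finally show ?thesis by simp
  qed
  moreover have "det D = 1 / s * (\<Prod>i\<in>UNIV. 1 / p i)"
    by (subst det_diagonal) (auto simp: D_def prod_UNIV_option)
  ultimately have det: "det \<Sigma> = 1 / s * (\<Prod>i\<in>UNIV. 1 / p i)"
    by (simp add: \<Sigma>_eq det_mul)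

  define z where "z = x - c"
  have Nz: "(N *v z) $ u = (case u of None \<Rightarrow> z $ None | Some i \<Rightarrow> z $ Some i - r i * z $ None)" for u
    by (cases u) (simp_all add: matrix_vector_mult_def N_def sum_UNIV_option mult_delta_left mult_delta_right sum_negf
        sum.delta cong: if_cong)
  have Ev: "(E *v v) $ u = (case u of None \<Rightarrow> s | Some i \<Rightarrow> p i) * v $ u" for u v
    by (simp add: matrix_vector_mult_def E_def mult_delta_left mult_delta_right sum.delta cong: if_cong)
  \<comment> \<open>Moving \<open>transpose N\<close> across the inner product leaves the diagonal
    form \<open>E\<close> in the regression residuals \<open>N *v z\<close>.\<close>
  have "z \<bullet> (matrix_inv \<Sigma> *v z) = (N *v z) \<bullet> (E *v (N *v z))"
    unfolding inv by (metis dot_lmul_matrix inner_commute matrix_vector_mul_assoc transpose_matrix_vector)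
  then have quad: "z \<bullet> (matrix_inv \<Sigma> *v z) =
      s * (z $ None)\<^sup>2 + (\<Sum>i\<in>UNIV. p i * (z $ Some i - r i * z $ None)\<^sup>2)"
    by (simp add: inner_vec_def sum_UNIV_option Nz Ev power2_eq_square mult.left_commute)
  have nd: "normal_density a (1 / sqrt q) t = sqrt q / sqrt (2 * pi) * exp (- (q * (t - a)\<^sup>2) / 2)" if "q > 0" for a q t
    using that by (simp add: normal_density_def real_sqrt_divide real_sqrt_mult power_divide field_simps)
  show ?thesis
  proof -
    have sqrt_prod: "sqrt (\<Prod>i\<in>A. f i) = (\<Prod>i\<in>A. sqrt (f i))" for A :: "'k set" and f
      by (induction A rule: infinite_finite_induct) (auto simp: real_sqrt_mult)
    \<comment> \<open>The exponent of \<open>2 * pi\<close> is K + 1, so each of the K + 1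
      univariate densities receives one factor \<open>sqrt (2 * pi)\<close>.\<close>
    have norm: "1 / sqrt ((2 * pi) ^ CARD('k option) * det \<Sigma>) =
        sqrt s / sqrt (2 * pi) * (\<Prod>i\<in>UNIV. sqrt (p i) / sqrt (2 * pi))"
      by (simp add: det sqrt_prod real_sqrt_mult real_sqrt_divide real_sqrt_power prod_dividef power_mult_distrib)
    have ex: "exp (- (z \<bullet> (matrix_inv \<Sigma> *v z)) / 2) = exp (- (s * (z $ None)\<^sup>2) / 2) *
        (\<Prod>i\<in>UNIV. exp (- (p i * (z $ Some i - r i * z $ None)\<^sup>2) / 2))"
      by (simp add: quad exp_sum[symmetric] exp_add[symmetric] sum_negf sum_divide_distrib
          add_divide_distrib diff_divide_distrib)
    have "mvn_density c \<Sigma> x =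
        exp (- (z \<bullet> (matrix_inv \<Sigma> *v z)) / 2) * (1 / sqrt ((2 * pi) ^ CARD('k option) * det \<Sigma>))"
      by (simp only: mvn_density_def z_def times_divide_eq_right mult_1_right)
    also have "\<dots> = (exp (- (s * (z $ None)\<^sup>2) / 2) *
          (\<Prod>i\<in>UNIV. exp (- (p i * (z $ Some i - r i * z $ None)\<^sup>2) / 2))) *
        (sqrt s / sqrt (2 * pi) * (\<Prod>i\<in>UNIV. sqrt (p i) / sqrt (2 * pi)))"
      by (simp only: norm ex)
    also have "\<dots> = (sqrt s / sqrt (2 * pi) * exp (- (s * (z $ None)\<^sup>2) / 2)) *
        (\<Prod>i\<in>UNIV. sqrt (p i) / sqrt (2 * pi) * exp (- (p i * (z $ Some i - r i * z $ None)\<^sup>2) / 2))"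
      by (simp only: prod.distrib ac_simps)
    also have "\<dots> = normal_density (c $ None) (1 / sqrt s) (x $ None) *
        (\<Prod>i\<in>UNIV. normal_density (c $ Some i + r i * (x $ None - c $ None)) (1 / sqrt (p i)) (x $ Some i))"
      by (simp only: nd assms(1,2) z_def vector_minus_component diff_diff_eq)
    finally show ?thesis .
  qed
qed

section \<open>The functions \<open>h1\<close> and \<open>h2\<close> as minima of two Gamma
  densities\<close>

lemma h1_eq_min:
  assumes "0 < a1" "0 < b1" "0 < d" "0 < \<phi>1" "0 < K"
  shows "h1 K a1 b1 d \<phi>1 = (\<lambda>x. min (gamma_density (real K / 2 + a1) b1 x)
    (gamma_density (real K / 2 + a1) (d / (2 * \<phi>1) + b1) x))"
proof -
  let ?B = "d / (2 * \<phi>1) + b1"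
  \<comment> \<open>The threshold is the crossing point for the rates \<open>b1\<close> and
    \<open>?B\<close>, whose difference is \<open>d / (2 * \<phi>1)\<close>.\<close>
  have "lambda_theta_star K a1 b1 d \<phi>1 = (real K / 2 + a1) / (?B - b1) * ln (?B / b1)"
    using assms by (simp add: lambda_theta_star_def field_simps)
  then show ?thesis
    using assms by (simp add: fun_eq_iff h1_def min_gamma_density)
qed

lemma SSE_nonneg: "0 \<le> SSE m y"
  by (simp add: SSE_def sum_nonneg)

text \<open>Here the smaller rate already contains \<open>SSE m y / 2\<close>; the rates differ by
  \<open>d / (2 * \<phi>2)\<close>, and \<open>lambda_e_star\<close> is again the crossing
  point.\<close>

lemma h2_eq_min:
  assumes "0 < a2" "0 < b2" "0 < d" "0 < \<phi>2"
  shows "h2 m y a2 b2 d \<phi>2 = (\<lambda>x. min (gamma_density (real (total_obs m) / 2 + a2) (SSE m y / 2 + b2) x)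
    (gamma_density (real (total_obs m) / 2 + a2) ((\<phi>2 * SSE m y + d) / (2 * \<phi>2) + b2) x))"
proof -
  let ?b = "SSE m y / 2 + b2" and ?B = "(\<phi>2 * SSE m y + d) / (2 * \<phi>2) + b2"
  have b: "0 < ?b" using SSE_nonneg[of m y] assms by linarith
  have diff: "?B - ?b = d / (2 * \<phi>2)" using assms by (simp add: field_simps)
  have "?B / ?b = 1 + (?B - ?b) / ?b" using b by (simp add: field_simps)
  also have "\<dots> = 1 + d / (\<phi>2 * (2 * b2 + SSE m y))"
    using assms b by (simp add: diff) (simp add: field_simps)
  finally have "lambda_e_star m y a2 b2 d \<phi>2 = (real (total_obs m) / 2 + a2) / (?B - ?b) * ln (?B / ?b)"
    using assms by (simp add: lambda_e_star_def diff) (simp add: field_simps)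
  moreover have "?b < ?B" using diff assms by (smt (verit) divide_pos_pos)
  ultimately show ?thesis
    using assms b by (simp add: fun_eq_iff h2_def min_gamma_density)
qed

section \<open>Measurability, sign and normalization of the minima\<close>

lemma gamma_density_measurable [measurable]: "gamma_density \<alpha> \<beta> \<in> borel_measurable borel"
  unfolding gamma_density_def[abs_def] by measurable

lemma gamma_density_nonneg: "0 < \<alpha> \<Longrightarrow> 0 \<le> gamma_density \<alpha> \<beta> x"
  by (simp add: gamma_density_def Gamma_real_nonneg)

lemma gamma_density_pos: "0 < \<alpha> \<Longrightarrow> 0 < \<beta> \<Longrightarrow> 0 < x \<Longrightarrow> 0 < gamma_density \<alpha> \<beta> x"
  by (simp add: gamma_density_def Gamma_real_pos)

lemma gamma_density_nonpos [simp]: "x \<le> 0 \<Longrightarrow> gamma_density \<alpha> \<beta> x = 0"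
  by (simp add: gamma_density_def)

text \<open>Supplies the normalizing constants of \<open>q_density\<close>. Since \<open>h\<close>
  vanishes off the positive half-line, the set integral is the integral over the whole line.\<close>

lemma min_gamma_integral:
  fixes \<alpha> b B :: real
  defines "h \<equiv> \<lambda>x. min (gamma_density \<alpha> b x) (gamma_density \<alpha> B x)"
  assumes "0 < \<alpha>" "0 < b" "0 < B"
  shows "0 < (LBINT x:{0<..}. h x)"
    and "(\<integral>\<^sup>+x. ennreal (h x / (LBINT x:{0<..}. h x)) \<partial>lborel) = 1"
proof -
  have int: "integrable lborel h"
    unfolding h_def using assms by (intro integrable_min integrable_gamma_density)
  have nn: "0 \<le> h x" for x
    using assms by (simp add: h_def gamma_density_nonneg)
  have eq: "(LBINT x:{0<..}. h x) = integral\<^sup>L lborel h"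
    unfolding set_lebesgue_integral_def
    by (intro Bochner_Integration.integral_cong) (auto simp: h_def indicator_def)
  have pos: "0 < integral\<^sup>L lborel h"
    using int nn assms
    by (intro integral_pos_of_pos_on_halfline) (auto simp: h_def gamma_density_pos)
  show "0 < (LBINT x:{0<..}. h x)"
    using pos eq by simp
  have "(\<integral>\<^sup>+x. ennreal (h x / integral\<^sup>L lborel h) \<partial>lborel) = ennreal (\<integral>x. h x / integral\<^sup>L lborel h \<partial>lborel)"
    using int nn pos by (intro nn_integral_eq_integral) auto
  then show "(\<integral>\<^sup>+x. ennreal (h x / (LBINT x:{0<..}. h x)) \<partial>lborel) = 1"
    using pos by (simp add: eq)
qed

section \<open>Measurability and total mass of f(\<xi> | \<lambda>, y)\<close>

lemma nn_integral_normal_density: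
  "0 < \<sigma> \<Longrightarrow> (\<integral>\<^sup>+x. ennreal (normal_density \<mu> \<sigma> x) \<partial>lborel) = 1"
  by (simp add: nn_integral_eq_integral)

text \<open>Tonelli for a product of coordinate functions: \<open>nn_integral_lborel_prod\<close> is
  indexed by \<open>Basis\<close>, and \<open>ix\<close> translates a basis vector back into its
  coordinate index.\<close>

lemma nn_integral_vec_prod:
  fixes f :: "'k::finite \<Rightarrow> real \<Rightarrow> ennreal"
  assumes [measurable]: "\<And>i. f i \<in> borel_measurable borel"
  shows "(\<integral>\<^sup>+\<theta>. (\<Prod>i\<in>UNIV. f i (\<theta> $ i)) \<partial>lborel) = (\<Prod>i\<in>UNIV. \<integral>\<^sup>+x. f i x \<partial>lborel)"
proof -
  define ix :: "real ^ 'k \<Rightarrow> 'k" where "ix b = (SOME i. b = axis i 1)" for b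
  have ix: "ix (axis i 1) = i" for i
    unfolding ix_def by (rule some_equality) (auto simp: axis_eq_axis)
  have B: "bij_betw (\<lambda>i. axis i 1) UNIV (Basis :: (real ^ 'k) set)"
    by (auto simp: bij_betw_def Basis_vec_def inj_on_def axis_eq_axis)
  have "(\<integral>\<^sup>+\<theta>. (\<Prod>b\<in>(Basis :: (real ^ 'k) set). f (ix b) (\<theta> \<bullet> b)) \<partial>lborel) =
      (\<Prod>b\<in>(Basis :: (real ^ 'k) set). \<integral>\<^sup>+x. f (ix b) x \<partial>lborel)"
    by (rule nn_integral_lborel_prod) auto
  then show ?thesis
    by (simp add: prod.reindex_bij_betw[OF B, symmetric] ix inner_axis)
qed

text \<open>
  Unlike \<open>xi_cond\<close>, this expression is visibly measurable in the precisions; the two agree for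
  positive precisions.
\<close>

definition xi_cond_product ::
  "('k::finite \<Rightarrow> nat) \<Rightarrow> ('k \<Rightarrow> nat \<Rightarrow> real) \<Rightarrow> real \<Rightarrow> real \<Rightarrow> real \<Rightarrow> real \<Rightarrow> real ^ 'k \<Rightarrow> real \<Rightarrow> real"
where
  "xi_cond_product m y m0 s0 lt le \<theta> \<mu> =
     normal_density (mu_mean m y m0 s0 lt le) (1 / sqrt (s0 + t_sum m lt le)) \<mu> *
     (\<Prod>i\<in>UNIV. normal_density ((lt * \<mu> + real (m i) * le * ybar m y i) / (lt + real (m i) * le))
        (1 / sqrt (lt + real (m i) * le)) (\<theta> $ i))"

lemma xi_cond_product_nonneg: "0 \<le> xi_cond_product m y m0 s0 lt le \<theta> \<mu>"
  by (simp add: xi_cond_product_def prod_nonneg)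

lemma t_sum_nonneg: "0 \<le> lt \<Longrightarrow> 0 \<le> le \<Longrightarrow> 0 \<le> t_sum m lt le"
  by (simp add: t_sum_def sum_nonneg)

lemma xi_cond_eq_product:
  assumes "0 < lt" "0 < le" "0 < s0"
  shows "xi_cond m y m0 s0 lt le \<theta> \<mu> = xi_cond_product m y m0 s0 lt le \<theta> \<mu>"
proof -
  let ?p = "\<lambda>i. lt + real (m i) * le" and ?s = "s0 + t_sum m lt le"
  have p: "0 < ?p i" for i using assms by (simp add: add_pos_nonneg)
  have s: "0 < ?s" using assms t_sum_nonneg[of lt le m] by simp
  \<comment> \<open>The regression slope of \<theta> on \<mu> is \<open>lt / ?p i\<close>; the extra
    \<open>1 / ?p i\<close> on the diagonal is the conditional variance.\<close>
  have cov: "xi_cov m s0 lt le = (\<chi> u w. case (u, w) of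
          (None, None) \<Rightarrow> 1 / ?s
        | (Some i, None) \<Rightarrow> lt / ?p i / ?s
        | (None, Some j) \<Rightarrow> lt / ?p j / ?s
        | (Some i, Some j) \<Rightarrow> (if i = j then 1 / ?p i else 0) + lt / ?p i * (lt / ?p j) / ?s)"
    by (auto simp: vec_eq_iff xi_cov_def Let_def split: option.split)
       (simp_all add: power2_eq_square add_divide_distrib)
  \<comment> \<open>Conditioning on \<mu> replaces its mean \<nu> by \<mu> itself in the mean of the
    \<theta> coordinate.\<close>
  have mean: "(lt * \<nu> + w) / ?p i + lt * (\<mu> - \<nu>) / ?p i = (lt * \<mu> + w) / ?p i" for i w \<nu>
    by (simp add: add_divide_distrib[symmetric] algebra_simps)
  show ?thesis
    unfolding xi_cond_def mvn_density_hierarchical[OF s p cov] xi_cond_product_def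
    by (simp add: xi_mean_def xi_vec_def mean)
qed

lemma xi_cond_product_measurable [measurable]:
  fixes m :: "'k::finite \<Rightarrow> nat"
  shows
  "(\<lambda>z. xi_cond_product m y m0 s0 (fst (fst z)) (snd (fst z)) (fst (snd z)) (snd (snd z)))
    \<in> borel_measurable ((borel \<Otimes>\<^sub>M borel) \<Otimes>\<^sub>M (borel \<Otimes>\<^sub>M borel))"
proof -
  let ?M = "(borel \<Otimes>\<^sub>M borel) \<Otimes>\<^sub>M (borel \<Otimes>\<^sub>M borel) :: 'k state measure"
  have [measurable]: "(\<lambda>z. fst (snd z) $ i) \<in> borel_measurable ?M" for i
    by (rule measurable_compose[OF _ borel_measurable_nth]) measurable
  have [measurable]: "(\<lambda>z. fst (fst z)) \<in> borel_measurable ?M"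
    and [measurable]: "(\<lambda>z. snd (fst z)) \<in> borel_measurable ?M"
    and [measurable]: "(\<lambda>z. snd (snd z)) \<in> borel_measurable ?M"
    by measurable
  have [measurable]: "(\<lambda>z. t_sum m (fst (fst z)) (snd (fst z))) \<in> borel_measurable ?M"
    unfolding t_sum_def by measurable
  have [measurable]: "(\<lambda>z. mu_mean m y m0 s0 (fst (fst z)) (snd (fst z))) \<in> borel_measurable ?M"
    unfolding mu_mean_def by measurable
  show ?thesis
    unfolding xi_cond_product_def normal_density_def by measurable
qed

lemma xi_cond_product_measurable' [measurable]:
  "(\<lambda>\<xi>. xi_cond_product m y m0 s0 lt le (fst \<xi>) (snd \<xi>)) \<in> borel_measurable (borel \<Otimes>\<^sub>M borel)"
  using measurable_compose[OF measurable_Pair1' xi_cond_product_measurable, of "(lt, le)"]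
  by (simp add: space_pair_measure)

text \<open>For fixed \<mu> the \<theta> coordinates integrate out to 1 each, leaving the normal
  density of \<mu>.\<close>

lemma nn_integral_xi_cond_product:
  assumes "0 < lt" "0 < le" "0 < s0"
  shows "(\<integral>\<^sup>+\<xi>. ennreal (xi_cond_product m y m0 s0 lt le (fst \<xi>) (snd \<xi>)) \<partial>lborel) = 1"
proof -
  let ?p = "\<lambda>i. lt + real (m i) * le" and ?s = "s0 + t_sum m lt le"
  have p: "0 < ?p i" for i using assms by (simp add: add_pos_nonneg)
  have s: "0 < ?s" using assms t_sum_nonneg[of lt le m] by simp
  let ?N = "\<lambda>i \<mu>. normal_density ((lt * \<mu> + real (m i) * le * ybar m y i) / ?p i) (1 / sqrt (?p i))"
  have inner: "(\<integral>\<^sup>+\<theta>. ennreal (xi_cond_product m y m0 s0 lt le \<theta> \<mu>) \<partial>lborel) =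
      ennreal (normal_density (mu_mean m y m0 s0 lt le) (1 / sqrt ?s) \<mu>)" for \<mu>
  proof -
    have "(\<integral>\<^sup>+\<theta>. (\<Prod>i\<in>UNIV. ennreal (?N i \<mu> (\<theta> $ i))) \<partial>lborel) = 1"
      using p by (subst nn_integral_vec_prod) (simp_all add: nn_integral_normal_density)
    then show ?thesis
      by (simp add: xi_cond_product_def ennreal_mult prod_nonneg prod_ennreal[symmetric] nn_integral_cmult)
  qed
  have "(\<integral>\<^sup>+\<xi>. ennreal (xi_cond_product m y m0 s0 lt le (fst \<xi>) (snd \<xi>)) \<partial>lborel) =
      (\<integral>\<^sup>+\<mu>. \<integral>\<^sup>+\<theta>. ennreal (xi_cond_product m y m0 s0 lt le \<theta> \<mu>) \<partial>lborel \<partial>lborel)"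
    unfolding lborel_prod[symmetric] by (subst lborel_pair.nn_integral_snd[symmetric]) simp_all
  also have "\<dots> = 1"
    using s by (simp add: inner nn_integral_normal_density)
  finally show ?thesis .
qed

section \<open>Total mass of \<open>q_density\<close> and the minorization\<close>

theorem proposition4p3:
  fixes m :: "'k::finite \<Rightarrow> nat" and y :: "'k \<Rightarrow> nat \<Rightarrow> real"
    and a1 b1 a2 b2 m0 s0 d \<phi>1 \<phi>2 :: real
  assumes "CARD('k) \<ge> 3" and "\<And>i. m i \<ge> 2"
    and "a1 > 0" and "b1 > 0" and "a2 > 0" and "b2 > 0" and "s0 > 0"
    and "d > 0" and "\<phi>1 > 0" and "\<phi>2 > 0"
  shows "is_prob_density (q_density m y a1 b1 a2 b2 m0 s0 d \<phi>1 \<phi>2) \<and>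
    (\<forall>lt le \<theta> \<mu> lt' le' \<theta>' \<mu>'.
       lt > 0 \<longrightarrow> le > 0 \<longrightarrow> lt' > 0 \<longrightarrow> le' > 0 \<longrightarrow> (\<theta>', \<mu>') \<in> C_B m y d \<phi>1 \<phi>2 \<longrightarrow>
       gibbs_density m y a1 b1 a2 b2 m0 s0 ((lt', le'), (\<theta>', \<mu>')) ((lt, le), (\<theta>, \<mu>))
         \<ge> epsilon_B m y a1 b1 a2 b2 d \<phi>1 \<phi>2 *
           q_density m y a1 b1 a2 b2 m0 s0 d \<phi>1 \<phi>2 ((lt, le), (\<theta>, \<mu>)))"
proof -
  let ?\<alpha>1 = "real CARD('k) / 2 + a1" and ?\<alpha>2 = "real (total_obs m) / 2 + a2"
  let ?B1 = "d / (2 * \<phi>1) + b1" and ?b2 = "SSE m y / 2 + b2"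
    and ?B2 = "(\<phi>2 * SSE m y + d) / (2 * \<phi>2) + b2"
  define g1 where "g1 = h1 CARD('k) a1 b1 d \<phi>1"
  define g2 where "g2 = h2 m y a2 b2 d \<phi>2"
  have g1: "g1 = (\<lambda>x. min (gamma_density ?\<alpha>1 b1 x) (gamma_density ?\<alpha>1 ?B1 x))"
    unfolding g1_def using assms by (intro h1_eq_min) auto
  have g2: "g2 = (\<lambda>x. min (gamma_density ?\<alpha>2 ?b2 x) (gamma_density ?\<alpha>2 ?B2 x))"
    unfolding g2_def using assms by (intro h2_eq_min) auto
  have \<alpha>: "0 < ?\<alpha>1" "0 < ?\<alpha>2" using assms by (auto intro: add_nonneg_pos)
  have b: "0 < b1" "0 < ?b2" "0 < ?B1" "0 < ?B2"
    using assms SSE_nonneg[of m y] by (auto intro!: add_nonneg_pos)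
  define c1 where "c1 = (LBINT x:{0<..}. g1 x)"
  define c2 where "c2 = (LBINT x:{0<..}. g2 x)"
  have c1: "0 < c1" "(\<integral>\<^sup>+x. ennreal (g1 x / c1) \<partial>lborel) = 1"
    unfolding c1_def g1 using min_gamma_integral[OF \<alpha>(1) b(1,3)] by auto
  have c2: "0 < c2" "(\<integral>\<^sup>+x. ennreal (g2 x / c2) \<partial>lborel) = 1"
    unfolding c2_def g2 using min_gamma_integral[OF \<alpha>(2) b(2,4)] by auto
  have nonneg: "0 \<le> g1 x" "0 \<le> g2 x" for x
    using \<alpha> by (simp_all add: g1 g2 gamma_density_nonneg)
  have zero: "g1 x = 0" "g2 x = 0" if "x \<le> 0" for x
    using that by (simp_all add: g1 g2)
  have [measurable]: "g1 \<in> borel_measurable borel" "g2 \<in> borel_measurable borel"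
    unfolding g1 g2 by measurable

  let ?q = "q_density m y a1 b1 a2 b2 m0 s0 d \<phi>1 \<phi>2"
  let ?X = "xi_cond_product m y m0 s0"
  \<comment> \<open>Where a precision is not positive, \<open>xi_cond\<close> and \<open>?X\<close>
    need not agree, but there \<open>g1\<close> or \<open>g2\<close> is 0, so the product form is
    valid on the whole space.\<close>
  have q_eq: "?q = (\<lambda>z. g1 (fst (fst z)) / c1 * (g2 (snd (fst z)) / c2) *
      ?X (fst (fst z)) (snd (fst z)) (fst (snd z)) (snd (snd z)))"
  proof
    fix z :: "'k state"
    obtain lt le \<theta> \<mu> where z: "z = ((lt, le), (\<theta>, \<mu>))" by (metis prod.exhaust)
    show "?q z = g1 (fst (fst z)) / c1 * (g2 (snd (fst z)) / c2) *
      ?X (fst (fst z)) (snd (fst z)) (fst (snd z)) (snd (snd z))"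
    proof (cases "0 < lt \<and> 0 < le")
      case True
      then show ?thesis
        using assms by (simp add: z xi_cond_eq_product g1_def g2_def c1_def c2_def)
    next
      case False
      then have "g1 lt = 0 \<or> g2 le = 0" using zero by (meson not_le)
      then show ?thesis by (auto simp: z g1_def[symmetric] g2_def[symmetric])
    qed
  qed
  have "?q \<in> borel_measurable ((borel \<Otimes>\<^sub>M borel) \<Otimes>\<^sub>M (borel \<Otimes>\<^sub>M borel))"
    unfolding q_eq by measurable
  then have meas: "?q \<in> borel_measurable lborel"
    by (simp add: borel_prod)
  \<comment> \<open>Tonelli: integrating over \<xi> first removes \<open>?X\<close>, after which the
    two precisions separate.\<close>
  have "(\<integral>\<^sup>+z. ennreal (?q z) \<partial>lborel) = (\<integral>\<^sup>+l. \<integral>\<^sup>+\<xi>. ennreal (?q (l, \<xi>)) \<partial>lborel \<partial>lborel)"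
    using lborel.nn_integral_fst[of "\<lambda>z. ennreal (?q z)" lborel] meas
    by (simp add: lborel_prod)
  also have "\<dots> = (\<integral>\<^sup>+l. ennreal (g1 (fst l) / c1) * ennreal (g2 (snd l) / c2) \<partial>lborel)"
  proof (rule nn_integral_cong)
    fix l :: "real \<times> real"
    show "(\<integral>\<^sup>+\<xi>. ennreal (?q (l, \<xi>)) \<partial>lborel) = ennreal (g1 (fst l) / c1) * ennreal (g2 (snd l) / c2)"
    proof (cases "0 < fst l \<and> 0 < snd l")
      case True
      have [measurable]: "(\<lambda>\<xi>. ?X (fst l) (snd l) (fst \<xi>) (snd \<xi>)) \<in> borel_measurable lborel"
        using xi_cond_product_measurable' by (simp add: borel_prod)
      have "ennreal (?q (l, \<xi>)) =
          ennreal (g1 (fst l) / c1) * ennreal (g2 (snd l) / c2) * ennreal (?X (fst l) (snd l) (fst \<xi>) (snd \<xi>))"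
        for \<xi>
        using c1(1) c2(1) nonneg by (simp add: q_eq ennreal_mult[symmetric] xi_cond_product_nonneg)
      then show ?thesis
        using True assms by (simp add: nn_integral_cmult nn_integral_xi_cond_product)
    next
      case False
      then have "g1 (fst l) = 0 \<or> g2 (snd l) = 0" using zero by (meson not_le)
      then show ?thesis by (auto simp: q_eq)
    qed
  qed
  also have "\<dots> = (\<integral>\<^sup>+x. \<integral>\<^sup>+x'. ennreal (g1 x / c1) * ennreal (g2 x' / c2) \<partial>lborel \<partial>lborel)"
    unfolding lborel_prod[symmetric] by (subst lborel.nn_integral_fst[symmetric]) simp_all
  also have "\<dots> = 1"
    by (simp add: nn_integral_cmult c1 c2)
  finally have density: "is_prob_density ?q"
    unfolding is_prob_density_def using meas nonneg c1(1) c2(1)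
    by (simp add: q_eq xi_cond_product_nonneg)

  have "epsilon_B m y a1 b1 a2 b2 d \<phi>1 \<phi>2 * ?q ((lt, le), (\<theta>, \<mu>)) \<le>
      gibbs_density m y a1 b1 a2 b2 m0 s0 ((lt', le'), (\<theta>', \<mu>')) ((lt, le), (\<theta>, \<mu>))"
    if pos: "0 < lt" "0 < le" and C: "(\<theta>', \<mu>') \<in> C_B m y d \<phi>1 \<phi>2" for lt le \<theta> \<mu> lt' le' \<theta>' \<mu>'
  proof -
    have v1: "0 \<le> v1 \<theta>' \<mu>'" "v1 \<theta>' \<mu>' < d / \<phi>1" and v2: "0 \<le> v2 m y \<theta>'" "v2 m y \<theta>' < d / \<phi>2"
      using C by (auto simp: C_B_def v1_def v2_def sum_nonneg)
    \<comment> \<open>The bounds on \<open>v1\<close> put the rate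
      \<open>v1 \<theta>' \<mu>' / 2 + b1\<close> between \<open>b1\<close> and
      \<open>?B1\<close>.\<close>
    have "g1 lt \<le> lambda_theta_cond a1 b1 \<theta>' \<mu>' lt"
      unfolding g1 lambda_theta_cond_def using v1 \<alpha> b by (intro gamma_density_ge_min) auto
    \<comment> \<open>This form shows \<open>?B2\<close> as the rate at which \<open>v2\<close> is
      replaced by its bound \<open>d / \<phi>2\<close>.\<close>
    moreover have "?B2 = (d / \<phi>2 + SSE m y) / 2 + b2"
      using assms by (simp add: field_simps)
    then have "g2 le \<le> lambda_e_cond m y a2 b2 \<theta>' le"
      unfolding g2 lambda_e_cond_def using v2 \<alpha> b by (intro gamma_density_ge_min) auto
    ultimately have "g1 lt * g2 le * ?X lt le \<theta> \<mu> \<le>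
        lambda_theta_cond a1 b1 \<theta>' \<mu>' lt * lambda_e_cond m y a2 b2 \<theta>' le * ?X lt le \<theta> \<mu>"
      using nonneg by (intro mult_right_mono mult_mono xi_cond_product_nonneg) (auto intro: order_trans)
    \<comment> \<open>The factor \<open>c1 * c2\<close> cancels the normalizing constants inside
      \<open>?q\<close>, so the claim reduces to the preceding inequality.\<close>
    moreover have "epsilon_B m y a1 b1 a2 b2 d \<phi>1 \<phi>2 = c1 * c2"
      by (simp add: epsilon_B_def c1_def c2_def g1_def g2_def)
    ultimately show ?thesis
      using c1(1) c2(1) pos assms by (simp add: q_eq xi_cond_eq_product)
  qed
  with density show ?thesis by blast
qed

end
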